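(* (Proof of the Collatz conjecture assuming the decidability test.) Assume the decidability test stated in the context. Then the Collatz conjecture holds, as follows. For the $3n+1$ conjecture the trivial root number is $c=3+1=4$. The numbers of the class $[c]_{2a^2}=[4]_{18}$, i.e. of the arithmetic progression $4,22,40,58,\dots$ with periodicity $2a^2=18$, in the range $4<n<54=2a^3$ are $22$ and $40$. Their root paths converge to the trivial root $c=4$, as they are located on the greedy branch to it; this can also be seen from the root path of $7$ via $22$ and $40$ to $4$: $7\to 22\to 11\to 34\to 17\to 52\to 26\to 13\to 40\to 20\to 10\to 5\to 16\to 8\to 4$.
   Context: For an $an+b$ function, each positive odd number $n$ is sent to $an+b$ and each positive even number $n$ to $n/2$; the inverse steps are $f:n\to (n-b)/a$ (when this is an odd integer) and $g:n\to 2n$. The root path of a number is the sequence of its successive iterates under the $an+b$ function. The trivial root is the root trajectory containing $n=1$, and its branching number $c=a\cdot 1+b=a+b$ is the trivial root number; a root path converges to $c$ if it reaches $c$. $[r]_m$ denotes the class of natural numbers with remainder $r$ modulo $m$. The branching numbers are the images $an+b$ of the odd numbers $n$ not divisible by $a$; for $3n+1$ they are the numbers congruent to $4$ or $16$ modulo $18$. Decidability test (assumed here): for an $an+b$ function with trivial root containing $1$ and trivial root number $c=a+b$, whether the root paths of all numbers $n$ from the branching class $[c]_{2a^2}$ in the range $c<n<2a^3$ converge to $c$ decides whether the root paths of all branching numbers converge to $c$. Collatz conjecture: under $n\to 3n+1$ for odd $n$ and $n\to n/2$ for even $n$, the root path of every natural number converges to the cyclic trivial root $4\to 2\to 1\to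 4\to\cdots$. Greedy branch (for $3n+1$): the sequence of branching numbers obtained from $4$ by first taking its upward child $16$ and then repeatedly applying the leftward function $L(n)=\frac{n-1}{3}\cdot 2^q$, where $q\ge 1$ is the least exponent for which $L(n)$ is again a branching number; it runs $4,\ 16,\ 40,\ 52,\ 34,\ 22,\dots$. *)

theory Defs
  imports Main
begin

definition step :: "nat \<Rightarrow> nat \<Rightarrow> nat \<Rightarrow> nat" where
  "step a b n = (if odd n then a * n + b else n div 2)"

definition root_path :: "nat \<Rightarrow> nat \<Rightarrow> nat \<Rightarrow> nat \<Rightarrow> nat" where
  "root_path a b n k = (step a b ^^ k) n"

definition converges_to :: "nat \<Rightarrow> nat \<Rightarrow> nat \<Rightarrow> nat \<Rightarrow> bool" where
  "converges_to a b n c \<longleftrightarrow> (\<exists>k. root_path a b n k = c)"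

definition trivial_root_number :: "nat \<Rightarrow> nat \<Rightarrow> nat" where
  "trivial_root_number a b = a * 1 + b"

(* The trivial root contains 1 in the sense that 1 is a cyclic point of the function. *)
definition one_in_trivial_root :: "nat \<Rightarrow> nat \<Rightarrow> bool" where
  "one_in_trivial_root a b \<longleftrightarrow> (\<exists>k>0. root_path a b 1 k = 1)"

definition branching_numbers :: "nat \<Rightarrow> nat \<Rightarrow> nat set" where
  "branching_numbers a b = {a * n + b | n. odd n \<and> \<not> a dvd n}"

definition residue_class :: "nat \<Rightarrow> nat \<Rightarrow> nat set" where
  "residue_class m r = {n. n mod m = r}"

definition test_numbers :: "nat \<Rightarrow> nat \<Rightarrow> nat set" where
  "test_numbers a b =
     {n \<in> residue_class (2 * a ^ 2) (trivial_root_number a b).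
        trivial_root_number a b < n \<and> n < 2 * a ^ 3}"

definition test_decides :: "nat \<Rightarrow> nat \<Rightarrow> bool" where
  "test_decides a b \<longleftrightarrow>
     ((\<forall>n\<in>test_numbers a b. converges_to a b n (trivial_root_number a b)) \<longleftrightarrow>
      (\<forall>n\<in>branching_numbers a b. converges_to a b n (trivial_root_number a b)))"

(* Parity: odd numbers are meant to be sent to even ones by n -> a n + b.
   The bound on c = a + b says that c is a remainder modulo 2 a^2, so that the class
   [c] modulo 2 a^2 exists and contains c.  Without it the range c < n < 2 a^3 may be
   empty and the test false, e.g. a = 3, b = 61 with the additional cycle 61, 244, 122. *)
definition decidability_test :: bool where
  "decidability_test \<longleftrightarrow>
     (\<forall>a b. odd a \<and> odd b \<and> trivial_root_number a b < 2 * a ^ 2 \<and> one_in_trivial_root a b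
        \<longrightarrow> test_decides a b)"

(* From some index on, the root path runs through 4, 2, 1, 4, 2, 1, ... *)
definition collatz_conjecture :: bool where
  "collatz_conjecture \<longleftrightarrow>
     (\<forall>n>0. \<exists>k. \<forall>i. root_path 3 1 n (k + i) = [4, 2, 1] ! (i mod 3))"

(* For a branching number n of 3n+1, n - 1 is divisible by 3 and (n - 1) div 3 is odd
   and not divisible by 3; since 2 generates the units modulo 9, the exponent exists. *)
definition leftward :: "nat \<Rightarrow> nat" where
  "leftward n =
     (n - 1) div 3 * 2 ^ (LEAST q. 1 \<le> q \<and> (n - 1) div 3 * 2 ^ q \<in> branching_numbers 3 1)"

fun greedy_branch :: "nat \<Rightarrow> nat" where
  "greedy_branch 0 = 4"
| "greedy_branch (Suc 0) = 16"
| "greedy_branch (Suc (Suc k)) = leftward (greedy_branch (Suc k))"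

end

(* On the greedy branch convergence holds without any test, since the root path of L(n) runs
   through (n - 1) / 3 back to n.  As 22 and 40 lie on it, the test yields the convergence of all
   branching numbers.  Every positive number reaches a branching number: halve it until it is odd,
   apply n -> 3n + 1, and repeat this once if the odd number was a multiple of 3. *)
theory Submission
  imports Defs
begin

lemma root_path_0 [simp]: "root_path a b n 0 = n"
  by (simp add: root_path_def)

lemma root_path_Suc: "root_path a b n (Suc k) = root_path a b (step a b n) k"
  by (simp only: root_path_def funpow_Suc_right o_apply)

text \<open>Form for evaluation by \<open>simp\<close>: a numeral \<open>k\<close> does not match
  \<open>Suc\<close>, whereas here it is counted down.\<close>

lemma root_path_rec:
  "root_path a b n k = (if k = 0 then n else root_path a b (step a b n) (k - 1))"
  by (cases k) (simp_all add: root_path_Suc)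

lemma root_path_add: "root_path a b n (k + l) = root_path a b (root_path a b n k) l"
  by (induction k arbitrary: n) (simp_all add: root_path_Suc)

lemma converges_to_refl: "converges_to a b n n"
  unfolding converges_to_def by (rule exI[of _ 0]) simp

lemma converges_to_trans:
  assumes "converges_to a b n m" and "converges_to a b m c"
  shows "converges_to a b n c"
  using assms unfolding converges_to_def by (metis root_path_add)

lemma converges_to_step:
  assumes "converges_to a b (step a b n) c"
  shows "converges_to a b n c"
  using assms unfolding converges_to_def by (metis root_path_Suc)

lemma converges_to_double: "converges_to a b (2 * n) n"
  by (rule converges_to_step) (simp add: step_def converges_to_refl)

lemma converges_to_mult_power2: "converges_to a b (n * 2 ^ q) n"
proof (induction q)
  case 0
  then show ?case by (simp add: converges_to_refl)
next
  case (Suc q)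
  have "converges_to a b (n * 2 ^ Suc q) (n * 2 ^ q)"
    using converges_to_double[of a b "n * 2 ^ q"] by (simp add: mult.left_commute)
  then show ?case using Suc.IH by (rule converges_to_trans)
qed

text \<open>An odd \<open>m\<close> prime to 3 is 1 or 5 modulo 6, and \<open>3 * m + 1\<close>
  turns these residues into 4 and 16 modulo 18.\<close>

lemma branching_numbers_3_1: "branching_numbers 3 1 = {n. n mod 18 = 4 \<or> n mod 18 = 16}"
proof (intro set_eqI iffI)
  fix n assume "n \<in> branching_numbers 3 1"
  then obtain m where "n = 3 * m + 1" "odd m" "\<not> 3 dvd m"
    by (auto simp: branching_numbers_def)
  then show "n \<in> {n. n mod 18 = 4 \<or> n mod 18 = 16}" by simp presburger
next
  fix n :: nat assume "n \<in> {n. n mod 18 = 4 \<or> n mod 18 = 16}"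
  then have "n = 3 * (n div 3) + 1 \<and> odd (n div 3) \<and> \<not> 3 dvd (n div 3)"
    by simp presburger
  then show "n \<in> branching_numbers 3 1" unfolding branching_numbers_def by blast
qed

text \<open>Modulo 9, \<open>m\<close> is a power of 2, and the targets 4 and 16 are the powers with
  exponents 2 and 4 modulo 6. The gaps between such exponents are 2 and 4, so some \<open>q\<close>
  from 1 to 4 works; \<open>q \<ge> 1\<close> makes the product even.\<close>

lemma ex_power2_branching:
  assumes "odd m" and "\<not> 3 dvd m"
  shows "\<exists>q\<ge>1. m * 2 ^ q \<in> branching_numbers 3 1"
proof -
  obtain r where r: "m mod 18 = r" by simp
  have "r = 1 \<or> r = 5 \<or> r = 7 \<or> r = 11 \<or> r = 13 \<or> r = 17"
    using assms r by presburger
  \<comment> \<open>Only the residue matters, which leaves a finite table over six values of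
    \<open>r\<close>.\<close>
  moreover have eq: "m * d mod 18 = r * d mod 18" for d
    by (simp add: mod_mult_left_eq flip: r)
  ultimately have "m * 2 ^ 1 mod 18 \<in> {4, 16} \<or> m * 2 ^ 2 mod 18 \<in> {4, 16}
      \<or> m * 2 ^ 3 mod 18 \<in> {4, 16} \<or> m * 2 ^ 4 mod 18 \<in> {4, 16}"
    unfolding eq by auto
  then show ?thesis
    unfolding branching_numbers_3_1 mem_Collect_eq insert_iff empty_iff
    by (metis one_le_numeral order_refl)
qed

lemma leftward_branching:
  assumes "n \<in> branching_numbers 3 1"
  shows "leftward n \<in> branching_numbers 3 1"
proof -
  obtain m where m: "n = 3 * m + 1" "odd m" "\<not> 3 dvd m"
    using assms by (auto simp: branching_numbers_def)
  have "\<exists>q. 1 \<le> q \<and> (n - 1) div 3 * 2 ^ q \<in> branching_numbers 3 1"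
    using ex_power2_branching[OF m(2,3)] m(1) by auto
  from LeastI_ex[OF this] show ?thesis by (simp add: leftward_def)
qed

lemma converges_to_leftward:
  assumes "n \<in> branching_numbers 3 1"
  shows "converges_to 3 1 (leftward n) n"
proof -
  obtain m where m: "n = 3 * m + 1" "odd m"
    using assms by (auto simp: branching_numbers_def)
  have "converges_to 3 1 (leftward n) m"
    using m(1) by (simp add: leftward_def converges_to_mult_power2)
  moreover have "converges_to 3 1 m n"
    by (rule converges_to_step) (use m in \<open>simp add: step_def converges_to_refl\<close>)
  ultimately show ?thesis by (rule converges_to_trans)
qed

text \<open>Membership is carried through the induction because both facts about
  \<open>leftward\<close> require a branching number.\<close>

lemma greedy_branch_converges:
  "greedy_branch k \<in> branching_numbers 3 1 \<and> converges_to 3 1 (greedy_branch k) 4"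
proof (induction k rule: greedy_branch.induct)
  case 1
  show ?case unfolding branching_numbers_3_1 by (simp add: converges_to_refl)
next
  case 2
  show ?case
    \<comment> \<open>16 is \<open>4 * 2 ^ 2\<close>, so two halvings reach 4.\<close>
    unfolding branching_numbers_3_1 using converges_to_mult_power2[of 3 1 4 2] by simp
next
  case (3 k)
  then show ?case
    unfolding greedy_branch.simps
    using leftward_branching converges_to_leftward converges_to_trans by blast
qed

lemma leftward_eqI:
  assumes "1 \<le> q" and "(n - 1) div 3 * 2 ^ q \<in> branching_numbers 3 1"
    and "\<forall>p\<in>{1..<q}. (n - 1) div 3 * 2 ^ p \<notin> branching_numbers 3 1"
  shows "leftward n = (n - 1) div 3 * 2 ^ q"
proof -
  have "(LEAST p. 1 \<le> p \<and> (n - 1) div 3 * 2 ^ p \<in> branching_numbers 3 1) = q"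
    by (rule Least_equality) (use assms in \<open>auto simp: not_less[symmetric]\<close>)
  then show ?thesis by (simp add: leftward_def)
qed

text \<open>The branch starts 4, 16, 40, 52, 34, 22, as 40 = 5 * 8, 52 = 13 * 4, 34 = 17 * 2 and 22
  = 11 * 2; the least exponents are 3, 2, 1, 1.\<close>

lemma greedy_branch_22_40: "greedy_branch 2 = 40" "greedy_branch 5 = 22"
proof -
  have "leftward 16 = 40"
    by (subst leftward_eqI[of 3])
      (simp_all add: branching_numbers_3_1 atLeastLessThan_upt upt_rec del: One_nat_def)
  then show 2: "greedy_branch 2 = 40" by (simp add: numeral_2_eq_2)
  have "leftward 40 = 52"
    by (subst leftward_eqI[of 2])
      (simp_all add: branching_numbers_3_1 atLeastLessThan_upt upt_rec del: One_nat_def)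
  moreover have "leftward 52 = 34"
    by (subst leftward_eqI[of 1]) (simp_all add: branching_numbers_3_1 del: One_nat_def)
  moreover have "leftward 34 = 22"
    by (subst leftward_eqI[of 1]) (simp_all add: branching_numbers_3_1 del: One_nat_def)
  ultimately show "greedy_branch 5 = 22"
    using 2 by (simp add: eval_nat_numeral)
qed

lemma residue_class_eq:
  assumes "r < m"
  shows "residue_class m r = {r + m * k | k. True}"
proof (intro set_eqI iffI)
  fix n assume "n \<in> residue_class m r"
  then have "n = r + m * (n div m)"
    by (simp add: residue_class_def) (metis mod_mult_div_eq)
  then show "n \<in> {r + m * k | k. True}" by blast
qed (use assms in \<open>auto simp: residue_class_def\<close>)

lemma residue_class_18_4_range: "{n \<in> residue_class 18 4. 4 < n \<and> n < 54} = {22, 40}"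
proof (intro set_eqI iffI)
  fix n assume "n \<in> {n \<in> residue_class 18 4. 4 < n \<and> n < 54}"
  then have "n mod 18 = 4" "4 < n" "n < 54" by (simp_all add: residue_class_def)
  then have "n = 22 \<or> n = 40" by presburger
  then show "n \<in> {22, 40}" by simp
qed (auto simp: residue_class_def)

lemma test_numbers_3_1: "test_numbers 3 1 = {22, 40}"
  using residue_class_18_4_range by (simp add: test_numbers_def trivial_root_number_def)

text \<open>A direct check of both test numbers: 22 occurs at index 1 and 40 at index 8, before 4 at
  index 14.\<close>

lemma root_path_7:
  "map (root_path 3 1 7) [0..<15] = [7, 22, 11, 34, 17, 52, 26, 13, 40, 20, 10, 5, 16, 8, 4]"
  by (simp add: upt_rec root_path_rec step_def)

text \<open>Halving preserves indivisibility by 3, so the first odd number reached has a branching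
  number as its image.\<close>

lemma converges_to_not_dvd_3:
  assumes "\<forall>n\<in>branching_numbers 3 1. converges_to 3 1 n c" and "\<not> 3 dvd n"
  shows "converges_to 3 1 n c"
  using assms(2)
proof (induction n rule: less_induct)
  case (less n)
  have "converges_to 3 1 (step 3 1 n) c"
  proof (cases "odd n")
    case True
    then have "3 * n + 1 \<in> branching_numbers 3 1"
      using less.prems by (auto simp: branching_numbers_def)
    then show ?thesis using assms(1) True by (simp add: step_def)
  next
    case False
    \<comment> \<open>The strict decrease holds since \<open>n\<close> is nonzero, 0 being divisible
      by 3.\<close>
    with less.prems have "n div 2 < n" "\<not> 3 dvd n div 2" by presburger+
    then show ?thesis using less.IH False by (simp add: step_def)
  qed
  then show ?case by (rule converges_to_step)
qed

lemma converges_to_if_branching_converge: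
  assumes "\<forall>n\<in>branching_numbers 3 1. converges_to 3 1 n c" and "n > 0"
  shows "converges_to 3 1 n c"
  using assms(2)
proof (induction n rule: less_induct)
  case (less n)
  have "converges_to 3 1 (step 3 1 n) c"
  proof (cases "odd n")
    case True
    \<comment> \<open>Even if 3 divides \<open>n\<close>, its image is 1 modulo 3, so the preceding
      lemma takes over after one odd step.\<close>
    moreover have "\<not> 3 dvd 3 * n + 1" by presburger
    ultimately show ?thesis
      using converges_to_not_dvd_3[OF assms(1)] by (simp add: step_def)
  next
    case False
    with less.prems have "n div 2 < n" "0 < n div 2" by presburger+
    then show ?thesis using less.IH False by (simp add: step_def)
  qed
  then show ?case by (rule converges_to_step)
qed

text \<open>Three steps lead from 4 back to 4, so the induction descends by 3 to the indices 0, 1,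
  2.\<close>

lemma root_path_4: "root_path 3 1 4 i = [4, 2, 1] ! (i mod 3)"
proof (induction i rule: less_induct)
  case (less i)
  consider "i = 0" | "i = 1" | "i = 2" | j where "i = 3 + j"
    by (metis One_nat_def Suc_1 le_Suc_ex less_2_cases_iff less_Suc_eq not_less numeral_3_eq_3)
  then show ?case
  proof cases
    case (4 j)
    have "root_path 3 1 4 3 = 4" by (simp add: root_path_rec step_def)
    then have "root_path 3 1 4 (3 + j) = root_path 3 1 4 j" by (simp only: root_path_add)
    then show ?thesis using less.IH[of j] 4 by simp
  qed (simp_all add: root_path_rec step_def)
qed

lemma collatz_conjecture_if_branching_converge:
  assumes "\<forall>n\<in>branching_numbers 3 1. converges_to 3 1 n 4"
  shows "collatz_conjecture"
  unfolding collatz_conjecture_def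
proof (intro allI impI)
  fix n :: nat assume "n > 0"
  with assms obtain k where "root_path 3 1 n k = 4"
    using converges_to_if_branching_converge unfolding converges_to_def by blast
  then show "\<exists>k. \<forall>i. root_path 3 1 n (k + i) = [4, 2, 1] ! (i mod 3)"
    by (metis root_path_add root_path_4)
qed

theorem theorem1p7:
  assumes "decidability_test"
  shows "trivial_root_number 3 1 = 4
    \<and> (2::nat) * 3 ^ 2 = 18 \<and> (2::nat) * 3 ^ 3 = 54
    \<and> residue_class 18 4 = {4 + 18 * k | k. True}
    \<and> {n \<in> residue_class 18 4. 4 < n \<and> n < 54} = {22, 40}
    \<and> test_numbers 3 1 = {22, 40}
    \<and> {22, 40} \<subseteq> range greedy_branch
    \<and> (\<forall>n \<in> range greedy_branch. converges_to 3 1 n 4)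
    \<and> converges_to 3 1 22 4 \<and> converges_to 3 1 40 4
    \<and> map (root_path 3 1 7) [0..<15] = [7, 22, 11, 34, 17, 52, 26, 13, 40, 20, 10, 5, 16, 8, 4]
    \<and> collatz_conjecture"
proof -
  have greedy: "\<forall>n \<in> range greedy_branch. converges_to 3 1 n 4"
    using greedy_branch_converges by auto
  have range: "{22, 40} \<subseteq> range greedy_branch"
    using greedy_branch_22_40 by (metis empty_subsetI insert_subset rangeI)
  have c: "trivial_root_number 3 1 = 4" by (simp add: trivial_root_number_def)
  \<comment> \<open>The cycle 1, 4, 2, 1 has length 3.\<close>
  have "root_path 3 1 1 3 = 1" by (simp add: root_path_rec step_def)
  then have "one_in_trivial_root 3 1"
    unfolding one_in_trivial_root_def by (metis zero_less_numeral)
  \<comment> \<open>The side conditions hold: 3 and 1 are odd, and 4 < 18.\<close>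
  then have "test_decides 3 1"
    using assms c by (simp add: decidability_test_def)
  \<comment> \<open>Read from left to right, the equivalence extends convergence from 22 and 40 to
    all branching numbers.\<close>
  then have "\<forall>n\<in>branching_numbers 3 1. converges_to 3 1 n 4"
    using greedy range unfolding test_decides_def c test_numbers_3_1 by blast
  then have "collatz_conjecture" by (rule collatz_conjecture_if_branching_converge)
  moreover have "residue_class 18 4 = {4 + 18 * k | k. True}" by (rule residue_class_eq) simp
  moreover have "converges_to 3 1 22 4" "converges_to 3 1 40 4" using greedy range by blast+
  ultimately show ?thesis
    using c residue_class_18_4_range test_numbers_3_1 range greedy root_path_7 by simp
qed

end
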